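(* (i) (Detailed balance) For all $v,v'\in\mathbb R^3$, $$k(v,v')\exp\Big\{-\frac{m_1}{2\vartheta_1}(1+\mu)|v'-u_1|^2\Big\}=k(v',v)\exp\Big\{-\frac{m_1}{2\vartheta_1}(1+\mu)|v-u_1|^2\Big\}.$$ (ii) Let $\vartheta^\#=\frac{(1-\alpha)(1-\beta)}{1-\alpha(1-\beta)}\vartheta_1$ and $\mathcal M(v)=\big(\frac{m}{2\pi\vartheta^\#}\big)^{3/2}\exp\big(-\frac{m|v-u_1|^2}{2\vartheta^\#}\big)$. Then $Q\mathcal M=0$, $\int_{\mathbb R^3}\mathcal M\,dv=1$, and $\mathcal M$ is the unique equilibrium of $Q$ with unit mass: if $f\in L^1(\mathbb R^3,(1+\sigma(v))dv)$ satisfies $Qf=0$ a.e. and $\int_{\mathbb R^3}f\,dv=1$, then $f=\mathcal M$.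
   Context: Fix masses $m,m_1>0$, a constant restitution coefficient $\epsilon\in(0,1)$, a bulk velocity $u_1\in\mathbb R^3$ and a temperature $\vartheta_1>0$. Let $\mathcal M_1(v)=\big(\frac{m_1}{2\pi\vartheta_1}\big)^{3/2}\exp\big(-\frac{m_1|v-u_1|^2}{2\vartheta_1}\big)$. Set $\alpha=\frac{m_1}{m+m_1}$, $\beta=\frac{1-\epsilon}{2}$, $\gamma=\alpha\frac{1-\beta}{1-2\beta}$, $\bar\gamma=(1-\alpha)\frac{1-\beta}{1-2\beta}$ and $\mu=\frac{1-2\alpha(1-\beta)}{\alpha(1-\beta)}$ (note $1+\mu>0$). For $v,w\in\mathbb R^3$, $n\in\mathbb S^2$ and $q=v-w$, let $v_\star=v-2\gamma(q\cdot n)n$, $w_\star=w+2\bar\gamma(q\cdot n)n$. The gain operator is $Q^+f(v)=\epsilon^{-2}\int_{\mathbb R^3\times\mathbb S^2}|q\cdot n|\,f(v_\star)\mathcal M_1(w_\star)\,dw\,dn$, the collision frequency is $\sigma(v)=\int_{\mathbb R^3\times\mathbb S^2}|q\cdot n|\,\mathcal M_1(w)\,dw\,dn$, and $Qf=Q^+f-\sigma f$. The kernel is $k(v,v')=\big(\frac{m_1}{2\pi\vartheta_1}\big)^{1/2}|v-v'|^{-1}\exp\big\{-\frac{m_1}{8\vartheta_1}\big((1+\mu)|v-v'|+\frac{|v-u_1|^2-|v'-u_1|^2}{|v-v'|}\big)^2\big\}$; one has $Q^+f(v)=\frac{1}{2\epsilon^2\gamma^2}\int k(v,v')f(v')dv'$.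 *)

theory Defs
  imports "HOL-Analysis.Analysis"
begin

type_synonym vec3 = "real ^ 3"

text \<open>Surface measure on the unit sphere S^2, realised as the cone measure:
  the integral of g over S^2 equals 3 times the Lebesgue integral of g(x/|x|)
  over the unit ball. It is a measure on the Borel sets of R^3 concentrated on S^2
  (total mass 4 pi).\<close>
definition sphere_measure :: "vec3 measure" where
  "sphere_measure = scale_measure 3
     (distr (restrict_space lborel (ball 0 1 - {0})) borel (\<lambda>x. x /\<^sub>R norm x))"

definition alpha :: "real \<Rightarrow> real \<Rightarrow> real" where
  "alpha m m1 = m1 / (m + m1)"

definition beta :: "real \<Rightarrow> real" where
  "beta eps = (1 - eps) / 2"

definition gamma :: "real \<Rightarrow> real \<Rightarrow> real \<Rightarrow> real" where
  "gamma m m1 eps = alpha m m1 * (1 - beta eps) / (1 - 2 * beta eps)"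

definition gammabar :: "real \<Rightarrow> real \<Rightarrow> real \<Rightarrow> real" where
  "gammabar m m1 eps = (1 - alpha m m1) * (1 - beta eps) / (1 - 2 * beta eps)"

definition mu :: "real \<Rightarrow> real \<Rightarrow> real \<Rightarrow> real" where
  "mu m m1 eps = (1 - 2 * alpha m m1 * (1 - beta eps)) / (alpha m m1 * (1 - beta eps))"

definition M1 :: "real \<Rightarrow> vec3 \<Rightarrow> real \<Rightarrow> vec3 \<Rightarrow> real" where
  "M1 m1 u1 th1 v = (m1 / (2 * pi * th1)) powr (3/2) * exp (- (m1 * (norm (v - u1))\<^sup>2) / (2 * th1))"

definition vstar :: "real \<Rightarrow> real \<Rightarrow> real \<Rightarrow> vec3 \<Rightarrow> vec3 \<Rightarrow> vec3 \<Rightarrow> vec3" where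
  "vstar m m1 eps v w n = v - (2 * gamma m m1 eps * ((v - w) \<bullet> n)) *\<^sub>R n"

definition wstar :: "real \<Rightarrow> real \<Rightarrow> real \<Rightarrow> vec3 \<Rightarrow> vec3 \<Rightarrow> vec3 \<Rightarrow> vec3" where
  "wstar m m1 eps v w n = w + (2 * gammabar m m1 eps * ((v - w) \<bullet> n)) *\<^sub>R n"

definition Qplus :: "real \<Rightarrow> real \<Rightarrow> real \<Rightarrow> vec3 \<Rightarrow> real \<Rightarrow> (vec3 \<Rightarrow> real) \<Rightarrow> vec3 \<Rightarrow> real" where
  "Qplus m m1 eps u1 th1 f v = (1 / eps\<^sup>2) *
     (\<integral>p. \<bar>(v - fst p) \<bullet> snd p\<bar> * f (vstar m m1 eps v (fst p) (snd p))
            * M1 m1 u1 th1 (wstar m m1 eps v (fst p) (snd p))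
        \<partial>(lborel \<Otimes>\<^sub>M sphere_measure))"

definition sigma :: "real \<Rightarrow> vec3 \<Rightarrow> real \<Rightarrow> vec3 \<Rightarrow> real" where
  "sigma m1 u1 th1 v =
     (\<integral>p. \<bar>(v - fst p) \<bullet> snd p\<bar> * M1 m1 u1 th1 (fst p) \<partial>(lborel \<Otimes>\<^sub>M sphere_measure))"

definition Qop :: "real \<Rightarrow> real \<Rightarrow> real \<Rightarrow> vec3 \<Rightarrow> real \<Rightarrow> (vec3 \<Rightarrow> real) \<Rightarrow> vec3 \<Rightarrow> real" where
  "Qop m m1 eps u1 th1 f v = Qplus m m1 eps u1 th1 f v - sigma m1 u1 th1 v * f v"

definition kern :: "real \<Rightarrow> real \<Rightarrow> real \<Rightarrow> vec3 \<Rightarrow> real \<Rightarrow> vec3 \<Rightarrow> vec3 \<Rightarrow> real" where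
  "kern m m1 eps u1 th1 v v' =
     sqrt (m1 / (2 * pi * th1)) / norm (v - v') *
     exp (- (m1 / (8 * th1)) *
       ((1 + mu m m1 eps) * norm (v - v')
         + ((norm (v - u1))\<^sup>2 - (norm (v' - u1))\<^sup>2) / norm (v - v'))\<^sup>2)"

definition theta_sharp :: "real \<Rightarrow> real \<Rightarrow> real \<Rightarrow> real \<Rightarrow> real" where
  "theta_sharp m m1 eps th1 =
     (1 - alpha m m1) * (1 - beta eps) / (1 - alpha m m1 * (1 - beta eps)) * th1"

definition Msharp :: "real \<Rightarrow> real \<Rightarrow> real \<Rightarrow> vec3 \<Rightarrow> real \<Rightarrow> vec3 \<Rightarrow> real" where
  "Msharp m m1 eps u1 th1 v =
     (m / (2 * pi * theta_sharp m m1 eps th1)) powr (3/2)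
       * exp (- (m * (norm (v - u1))\<^sup>2) / (2 * theta_sharp m m1 eps th1))"

end

theory Submission
  imports Defs "HOL-Probability.Distributions"
begin

text \<open>
  The Maxwellian is an equilibrium because, for each direction \<open>n\<close>, the product
  \<open>M(v\<^sub>\<star>) M\<^sub>1(w\<^sub>\<star>)\<close> equals \<open>M(v) M\<^sub>1(w')\<close>, where \<open>w'\<close> arises from \<open>w\<close> by stretching
  \<open>q \<bullet> n\<close> by the factor \<open>1/\<epsilon>\<close>; the Jacobian of this rank-one map and the weight \<open>\<bar>q \<bullet> n\<bar>\<close> together
  cancel the prefactor \<open>\<epsilon>\<^sup>-\<^sup>2\<close>.

  For uniqueness, conservation of mass gives \<open>\<integral>Q\<^sup>+\<bar>f\<bar> = \<integral>\<sigma>\<bar>f\<bar>\<close>. If \<open>Q f = 0\<close>, then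
  \<open>\<sigma>\<bar>f\<bar> = \<bar>Q\<^sup>+f\<bar> \<le> Q\<^sup>+\<bar>f\<bar>\<close>, so equality holds almost everywhere. Equality at a single \<open>v\<close> forces
  \<open>f(v\<^sub>\<star>)\<close> to have constant sign for almost all \<open>(w, n)\<close>, and since \<open>v\<^sub>\<star>\<close> sweeps out the whole
  space, \<open>f\<close> has constant sign almost everywhere. Applied to \<open>f - M\<close>, whose integral vanishes,
  this yields \<open>f = M\<close>.
\<close>

section \<open>Gaussian integrals and rank-one changes of variables\<close>

text \<open>The integrand factorises over the coordinates, and each factor is a multiple of the
  normal density with variance \<open>1 / (2 * a)\<close>.\<close>

lemma nn_integral_gaussian:
  fixes u :: vec3
  assumes a: "a > 0"
  shows "(\<integral>\<^sup>+x. ennreal (exp (- a * (norm (x - u))\<^sup>2)) \<partial>lborel) = ennreal ((pi / a) powr (3/2))"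
proof -
  have 1: "(\<integral>\<^sup>+x. ennreal (exp (- a * (x - s)\<^sup>2)) \<partial>lborel) = ennreal (sqrt (pi / a))" for s :: real
  proof -
    define d where "d = sqrt (1 / (2 * a))"
    have d: "d > 0" "d\<^sup>2 = 1 / (2 * a)" using a by (simp_all add: d_def)
    have *: "exp (- a * (x - s)\<^sup>2) = sqrt (pi / a) * normal_density s d x" for x
      using a by (simp add: normal_density_def d)
    have "(\<integral>\<^sup>+x. ennreal (normal_density s d x) \<partial>lborel) = 1"
      using d(1) by (subst nn_integral_eq_integral) auto
    then show ?thesis
      using a unfolding * by (simp add: ennreal_mult' nn_integral_cmult)
  qed
  have "exp (- a * (norm (x - u))\<^sup>2) = (\<Prod>b\<in>Basis. exp (- a * (x \<bullet> b - u \<bullet> b)\<^sup>2))" for x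
  proof -
    have "(norm (x - u))\<^sup>2 = (\<Sum>b\<in>Basis. (x \<bullet> b - u \<bullet> b)\<^sup>2)"
      unfolding power2_norm_eq_inner by (subst euclidean_inner) (simp add: inner_diff_left power2_eq_square)
    then show ?thesis by (simp add: exp_sum sum_distrib_left)
  qed
  then have "(\<integral>\<^sup>+x. ennreal (exp (- a * (norm (x - u))\<^sup>2)) \<partial>lborel)
      = (\<integral>\<^sup>+x. (\<Prod>b\<in>Basis. ennreal (exp (- a * (x \<bullet> b - u \<bullet> b)\<^sup>2))) \<partial>lborel)"
    by (simp add: prod_ennreal)
  also have "\<dots> = (\<Prod>b\<in>(Basis::vec3 set). ennreal (sqrt (pi / a)))"
    by (subst nn_integral_lborel_prod[where f = "\<lambda>b y. ennreal (exp (- a * (y - u \<bullet> b)\<^sup>2))"])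
       (simp_all only: 1, simp_all)
  also have "\<dots> = ennreal ((pi / a) powr (3/2))"
    using a by (simp add: ennreal_power powr_half_sqrt[symmetric] powr_power)
  finally show ?thesis .
qed

text \<open>The map stretches the direction \<open>n\<close> by \<open>c\<close> and fixes the
  orthogonal plane.\<close>

lemma det_rank_one_perturbation:
  fixes n :: vec3
  assumes "norm n = 1"
  shows "det (matrix (\<lambda>q. q + ((c - 1) * (q \<bullet> n)) *\<^sub>R n)) = c"
proof -
  have n: "n$1 * n$1 + n$2 * n$2 + n$3 * n$3 = 1"
    using assms by (simp add: norm_eq_1 inner_vec_def sum_3)
  have axis_nth_eq: "axis j 1 $ i = (if i = j then 1 else (0::real))" for i j :: 3
    by (simp add: axis_def)
  have m: "matrix (\<lambda>q. q + ((c - 1) * (q \<bullet> n)) *\<^sub>R n) $ i $ j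
      = (if i = j then 1 else 0) + (c - 1) * n$j * n$i" for i j
    by (simp add: matrix_def inner_axis' axis_nth_eq)
  have "det (matrix (\<lambda>q. q + ((c - 1) * (q \<bullet> n)) *\<^sub>R n))
     = 1 + (c - 1) * (n$1 * n$1 + n$2 * n$2 + n$3 * n$3)"
    unfolding det_3 m by (simp add: algebra_simps)
  with n show ?thesis by simp
qed

lemma lborel_rank_one:
  fixes n :: vec3
  assumes n: "norm n = 1" and c: "c \<noteq> 0"
  shows "lborel = density (distr lborel borel (\<lambda>q. q + ((c - 1) * (q \<bullet> n)) *\<^sub>R n)) (\<lambda>_. ennreal \<bar>c\<bar>)"
proof (rule lborel_eqI)
  define T where "T c q = q + ((c - 1) * (q \<bullet> n)) *\<^sub>R n" for c :: real and q
  have nn: "n \<bullet> n = 1" using n by (simp add: norm_eq_1)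
  have lin: "linear (T d)" for d
    by (intro linearI) (auto simp: T_def inner_add_left algebra_simps)
  have inv: "T c (T (1/c) q) = q" "T (1/c) (T c q) = q" for q
    using c by (auto simp: T_def inner_add_left nn algebra_simps add_divide_distrib diff_divide_distrib
        simp flip: scaleR_add_left)
  fix l u :: vec3
  assume lu: "\<And>b. b \<in> Basis \<Longrightarrow> l \<bullet> b \<le> u \<bullet> b"
  \<comment> \<open>The determinant formula concerns images, so the preimage of the box is written
    as its image under the inverse map \<open>T (1/c)\<close>.\<close>
  have pre: "T c -` box l u = T (1/c) ` box l u"
    using inv by (auto simp: image_iff) metis
  have Tm: "T c \<in> borel_measurable borel" unfolding T_def by measurable
  have "measure lebesgue (T (1/c) ` box l u) = \<bar>1/c\<bar> * measure lebesgue (box l u)"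
    "T (1/c) ` box l u \<in> lmeasurable"
    using measure_linear_image[OF lin, of "box l u" "1/c"] det_rank_one_perturbation[OF n, of "1/c"]
      measurable_linear_image[OF lin, of "box l u" "1/c"]
    by (simp_all add: T_def[abs_def])
  moreover have "T c -` box l u \<in> sets lborel"
    using measurable_sets_borel[OF Tm borel_open[OF open_box]] by simp
  then have "emeasure lborel (T c -` box l u) = emeasure lebesgue (T c -` box l u)"
    by simp
  ultimately have "emeasure lborel (T c -` box l u) = ennreal (\<bar>1/c\<bar> * measure lebesgue (box l u))"
    unfolding pre by (simp add: emeasure_eq_measure2)
  then have "emeasure (density (distr lborel borel (T c)) (\<lambda>_. ennreal \<bar>c\<bar>)) (box l u) = measure lborel (box l u)"
    using Tm c by (simp add: emeasure_density_const emeasure_distr flip: ennreal_mult)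
  also have "\<dots> = (\<Prod>b\<in>Basis. (u - l) \<bullet> b)"
    using lu by (simp add: measure_def emeasure_lborel_box prod_nonneg inner_diff_left)
  finally show "emeasure (density (distr lborel borel (\<lambda>q. q + ((c - 1) * (q \<bullet> n)) *\<^sub>R n)) (\<lambda>_. ennreal \<bar>c\<bar>)) (box l u)
      = (\<Prod>b\<in>Basis. (u - l) \<bullet> b)"
    unfolding T_def[abs_def] .
qed simp

text \<open>One factor \<open>1 / \<bar>c\<bar>\<close> is the Jacobian; the other arises because
  the map multiplies the weight \<open>\<bar>q \<bullet> n\<bar>\<close> by
  \<open>\<bar>c\<bar>\<close>. The collision integrals use it with \<open>c = 1 / eps\<close> and
  \<open>c = - 1 / eps\<close>, and both give the factor \<open>eps\<^sup>2\<close>.\<close>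

lemma nn_integral_rank_one_weighted:
  fixes n :: vec3
  assumes n: "norm n = 1" and c: "c \<noteq> 0" and [measurable]: "g \<in> borel_measurable borel"
  shows "(\<integral>\<^sup>+q. ennreal \<bar>q \<bullet> n\<bar> * g (q + ((c - 1) * (q \<bullet> n)) *\<^sub>R n) \<partial>lborel)
    = ennreal (1 / c\<^sup>2) * (\<integral>\<^sup>+q. ennreal \<bar>q \<bullet> n\<bar> * g q \<partial>lborel)"
proof -
  have nn: "n \<bullet> n = 1" using n by (simp add: norm_eq_1)
  have *: "\<bar>(q + ((c - 1) * (q \<bullet> n)) *\<^sub>R n) \<bullet> n\<bar> = \<bar>c\<bar> * \<bar>q \<bullet> n\<bar>" for q
    by (simp add: inner_add_left nn algebra_simps flip: abs_mult)
  have cc: "ennreal (c\<^sup>2) = ennreal \<bar>c\<bar> * ennreal \<bar>c\<bar>"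
    by (simp add: power2_eq_square flip: ennreal_mult')
  have "(\<integral>\<^sup>+q. ennreal \<bar>q \<bullet> n\<bar> * g q \<partial>lborel) =
      (\<integral>\<^sup>+q. ennreal (c\<^sup>2) * (ennreal \<bar>q \<bullet> n\<bar> * g (q + ((c - 1) * (q \<bullet> n)) *\<^sub>R n)) \<partial>lborel)"
    by (subst lborel_rank_one[OF n c])
       (simp add: nn_integral_density nn_integral_distr * cc ennreal_mult' mult.assoc)
  also have "\<dots> = ennreal (c\<^sup>2) * (\<integral>\<^sup>+q. ennreal \<bar>q \<bullet> n\<bar> * g (q + ((c - 1) * (q \<bullet> n)) *\<^sub>R n) \<partial>lborel)"
    by (rule nn_integral_cmult) measurable
  finally show ?thesis
    using c by (simp add: mult.assoc[symmetric] flip: ennreal_mult)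
qed

lemma nn_integral_lborel_reflect:
  fixes v :: "'a :: euclidean_space"
  assumes [measurable]: "g \<in> borel_measurable borel"
  shows "(\<integral>\<^sup>+w. g w \<partial>lborel) = (\<integral>\<^sup>+q. g (v - q) \<partial>lborel)"
  by (subst lborel_affine[of "-1" v]) (simp_all add: nn_integral_density nn_integral_distr)

lemma nn_integral_lborel_translate:
  fixes v :: "'a :: euclidean_space"
  assumes [measurable]: "g \<in> borel_measurable borel"
  shows "(\<integral>\<^sup>+x. g x \<partial>lborel) = (\<integral>\<^sup>+x. g (x + v) \<partial>lborel)"
  by (subst lborel_affine[of 1 v]) (simp_all add: nn_integral_density nn_integral_distr add.commute)

section \<open>Finiteness and null sets of the sphere measure\<close>

lemma space_sphere_measure [simp]: "space sphere_measure = UNIV"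
  by (simp add: sphere_measure_def space_scale_measure)

lemma sets_sphere_measure [simp, measurable_cong]: "sets sphere_measure = sets borel"
  by (simp add: sphere_measure_def)

lemma sphere_projection_measurable [measurable]:
  "(\<lambda>x::vec3. x /\<^sub>R norm x) \<in> borel_measurable (restrict_space lborel (ball 0 1 - {0}))"
  by (intro measurable_restrict_space1) measurable

lemma finite_measure_sphere_measure: "finite_measure sphere_measure"
proof
  have "emeasure sphere_measure (space sphere_measure) = 3 * emeasure lborel (ball (0::vec3) 1 - {0})"
    by (simp add: sphere_measure_def space_scale_measure emeasure_distr emeasure_restrict_space space_restrict_space)
  also have "\<dots> \<le> 3 * emeasure lborel (ball (0::vec3) 1)"
    by (intro mult_left_mono emeasure_mono) auto
  also have "\<dots> < \<infinity>"
    using emeasure_lborel_ball_finite[of "0::vec3" 1] by (simp add: ennreal_mult_less_top)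
  finally show "emeasure sphere_measure (space sphere_measure) \<noteq> \<infinity>" by simp
qed

interpretation sphere_measure: finite_measure sphere_measure
  by (rule finite_measure_sphere_measure)

interpretation sphere: pair_sigma_finite "lborel :: vec3 measure" sphere_measure
  by unfold_locales

text \<open>Scaling by 3 does not change the null sets; push-forward and restriction are then undone
  in turn. This moves questions about directions to Lebesgue measure.\<close>

lemma AE_sphere_measure_iff:
  assumes [measurable]: "Measurable.pred borel P"
  shows "(AE n in sphere_measure. P n) \<longleftrightarrow> (AE x in lborel. x \<in> ball 0 1 - {0} \<longrightarrow> P (x /\<^sub>R norm x))"
proof -
  have "(AE n in sphere_measure. P n) \<longleftrightarrow> 
    (AE n in distr (restrict_space lborel (ball 0 1 - {0})) borel (\<lambda>x. x /\<^sub>R norm x). P n)"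
    unfolding sphere_measure_def
    by (subst (1 2) AE_iff_measurable[OF _ refl]) (auto simp: space_scale_measure)
  also have "\<dots> \<longleftrightarrow> (AE x in restrict_space lborel (ball 0 1 - {0}). P (x /\<^sub>R norm x))"
    by (subst AE_distr_iff) auto
  also have "\<dots> \<longleftrightarrow> (AE x in lborel. x \<in> ball 0 1 - {0} \<longrightarrow> P (x /\<^sub>R norm x))"
    by (subst AE_restrict_space_iff) auto
  finally show ?thesis .
qed

lemma AE_sphere_norm: "AE n in sphere_measure. norm n = 1"
  by (subst AE_sphere_measure_iff) auto

section \<open>Null sets along rays and collision lines\<close>

lemma AE_lborel_obtain:
  fixes P :: "'a::euclidean_space \<Rightarrow> bool"
  assumes "AE x in lborel. P x"
  obtains x where "P x"
  using eventually_happens[OF assms] by (auto simp: ae_filter_eq_bot_iff)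

lemma AE_lborel_translate:
  fixes c :: "'a::euclidean_space"
  assumes [measurable]: "Measurable.pred borel P" and "AE x in lborel. P x"
  shows "AE x in lborel. P (c + x)"
proof -
  have "AE x in distr lborel borel ((+) c). P x" unfolding lborel_distr_plus by (rule assms(2))
  then show ?thesis by (subst (asm) AE_distr_iff) auto
qed

text \<open>Two applications of Fubini replace polar coordinates: first, almost every dilate of
  the unit ball meets the exceptional set in a null set; second, each point lies in the dilates by all
  factors larger than its distance from \<open>v\<close>, a set of factors of positive measure.\<close>
lemma AE_lborel_radial:
  fixes v :: vec3
  assumes [measurable]: "Measurable.pred borel Q"
    and ray: "AE x in lborel. norm x < 1 \<longrightarrow> (AE s in (lborel :: real measure). Q (v + s *\<^sub>R x))"
  shows "AE y in lborel. Q y"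
proof -
  have "AE x in lborel. AE s in (lborel :: real measure). norm x < 1 \<longrightarrow> Q (v + s *\<^sub>R x)"
    using ray by eventually_elim auto
  then have "AE s in (lborel :: real measure). AE x in lborel. norm x < 1 \<longrightarrow> Q (v + s *\<^sub>R x)"
    by (subst (asm) lborel_pair.AE_commute) measurable
  then have "AE s in (lborel :: real measure). AE y in lborel. norm (y - v) < s \<longrightarrow> Q y"
  proof eventually_elim
    case (elim s)
    show ?case
    proof (cases "s > 0")
      case True
      show ?thesis
        using elim True by (subst lborel_affine[of s v]) (auto simp: AE_density AE_distr_iff)
    next
      case False
      then have "\<not> norm (y - v) < s" for y using norm_ge_zero[of "y - v"] by linarith
      then show ?thesis by simp
    qed
  qed
  then have "AE y in lborel. AE s in (lborel :: real measure). norm (y - v) < s \<longrightarrow> Q y"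
    by (subst lborel_pair.AE_commute) measurable
  then show ?thesis
  proof eventually_elim
    case (elim y)
    show ?case
    proof (rule ccontr)
      assume "\<not> Q y"
      have "AE s in lborel. s \<notin> {norm (y - v)<..<norm (y - v) + 1}"
        using elim by eventually_elim (use \<open>\<not> Q y\<close> in auto)
      then have "{norm (y - v)<..<norm (y - v) + 1} \<in> null_sets lborel"
        by (simp add: AE_iff_null_sets)
      then show False by (simp add: null_sets_def)
    qed
  qed
qed

text \<open>For fixed \<open>n\<close> the point depends on \<open>w\<close> only through its
  component along \<open>n\<close>, and it runs through the whole line through \<open>v\<close> in
  direction \<open>n\<close>. So \<open>Q\<close> holds almost everywhere on almost every such line,
  which is the situation of \<open>AE_lborel_radial\<close>.\<close>

lemma AE_collision_rays:
  fixes v :: vec3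
  assumes Q[measurable]: "Measurable.pred borel Q" and k: "k \<noteq> 0"
    and ae: "AE p in lborel \<Otimes>\<^sub>M sphere_measure. Q (v - (k * ((v - fst p) \<bullet> snd p)) *\<^sub>R snd p)"
  shows "AE y in lborel. Q y"
proof (rule AE_lborel_radial[OF Q])
  have "AE w in lborel. AE n in sphere_measure. Q (v - (k * ((v - w) \<bullet> n)) *\<^sub>R n)"
    using sphere.AE_pair[OF ae] by simp
  then have "AE n in sphere_measure. AE w in lborel. Q (v - (k * ((v - w) \<bullet> n)) *\<^sub>R n)"
    by (subst (asm) sphere.AE_commute) measurable
  \<comment> \<open>Stated as the vanishing of an integral, the condition is visibly measurable in
    \<open>n\<close>, as the passage to the ball requires.\<close>
  also have "(\<lambda>n. AE w in lborel. Q (v - (k * ((v - w) \<bullet> n)) *\<^sub>R n)) =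
     (\<lambda>n. (\<integral>\<^sup>+w. indicator {y. \<not> Q y} (v - (k * ((v - w) \<bullet> n)) *\<^sub>R n) \<partial>lborel) = 0)"
    by (intro ext) (subst nn_integral_0_iff_AE, auto simp: indicator_def)
  finally have "AE x in lborel. x \<in> ball 0 1 - {0} \<longrightarrow>
     (\<integral>\<^sup>+w. indicator {y. \<not> Q y} (v - (k * ((v - w) \<bullet> (x /\<^sub>R norm x))) *\<^sub>R (x /\<^sub>R norm x)) \<partial>lborel) = 0"
    by (subst (asm) AE_sphere_measure_iff) measurable
  moreover have "AE x::vec3 in lborel. x \<noteq> 0" by (rule AE_lborel_singleton)
  ultimately show "AE x in lborel. norm x < 1 \<longrightarrow> (AE s in (lborel :: real measure). Q (v + s *\<^sub>R x))"
  proof (eventually_elim, intro impI)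
    fix x :: vec3
    assume elim: "x \<in> ball 0 1 - {0} \<longrightarrow>
     (\<integral>\<^sup>+w. indicator {y. \<not> Q y} (v - (k * ((v - w) \<bullet> (x /\<^sub>R norm x))) *\<^sub>R (x /\<^sub>R norm x)) \<partial>lborel) = (0::ennreal)"
       "x \<noteq> 0" "norm x < 1"
    define n where "n = x /\<^sub>R norm x"
    have n: "n \<bullet> n = 1" "x = norm x *\<^sub>R n"
      using elim by (auto simp: n_def dot_square_norm power2_eq_square)
    have w: "AE w in lborel. Q (v - (k * ((v - w) \<bullet> n)) *\<^sub>R n)"
      using elim by (subst (asm) nn_integral_0_iff_AE) (auto simp: n_def indicator_def)
    \<comment> \<open>Shifting \<open>w\<close> along \<open>n\<close> and exchanging the quantifiers transfers the statement from almost every \<open>w\<close> to almost every point of the line through \<open>v\<close> in direction \<open>n\<close>.\<close>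
    have "AE w in lborel. Q (v - (k * ((v - w) \<bullet> n + t)) *\<^sub>R n)" for t
      using AE_lborel_translate[OF _ w, of "- t *\<^sub>R n"] by (simp add: inner_diff_left inner_add_left n algebra_simps)
    then have "AE t in (lborel :: real measure). AE w in lborel. Q (v - (k * ((v - w) \<bullet> n + t)) *\<^sub>R n)"
      by simp
    then have "AE w in lborel. AE t in (lborel :: real measure). Q (v - (k * ((v - w) \<bullet> n + t)) *\<^sub>R n)"
      by (subst (asm) lborel_pair.AE_commute) measurable
    then obtain w where "AE t in (lborel :: real measure). Q (v - (k * ((v - w) \<bullet> n + t)) *\<^sub>R n)"
      by (rule AE_lborel_obtain)
    \<comment> \<open>Putting \<open>t = - ((v - w) \<bullet> n) - (norm x / k) * s\<close> cancels
      the dependence on \<open>w\<close> and leaves the point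
      \<open>v + (s * norm x) *\<^sub>R n\<close>.\<close>
    from AE_borel_affine[OF _ _ this, of "- norm x / k" "- ((v - w) \<bullet> n)"]
    have "AE s in (lborel :: real measure). Q (v + (s * norm x) *\<^sub>R n)"
      using k elim by (simp add: mult.commute)
    then show "AE s in (lborel :: real measure). Q (v + s *\<^sub>R x)"
      by (subst n) simp
  qed
qed

section \<open>Gaussians with linear weights\<close>

text \<open>Half of the exponent absorbs the linear factor:
  \<open>E = exp ((a/2) * y\<^sup>2)\<close> dominates both 1 and \<open>(a/2) * y\<^sup>2\<close>,
  so \<open>(1 + 2 / a) * E\<close> dominates \<open>1 + y\<^sup>2\<close> and hence also
  \<open>y\<close>. The other half remains as an integrable bound.\<close>

lemma integrable_linear_times_gaussian:
  fixes u :: vec3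
  assumes a: "a > 0"
  shows "integrable lborel (\<lambda>x. (c + d * norm (x - u)) * exp (- a * (norm (x - u))\<^sup>2))"
proof (rule Bochner_Integration.integrable_bound)
  have "integrable lborel (\<lambda>x. exp (- (a/2) * (norm (x - u))\<^sup>2))"
    using nn_integral_gaussian[of "a/2" u] a by (simp add: integrable_iff_bounded)
  then show "integrable lborel (\<lambda>x. ((\<bar>c\<bar> + \<bar>d\<bar>) * (1 + 2 / a)) * exp (- (a/2) * (norm (x - u))\<^sup>2))"
    by (rule integrable_mult_right)
  show "AE x in lborel. norm ((c + d * norm (x - u)) * exp (- a * (norm (x - u))\<^sup>2))
      \<le> norm (((\<bar>c\<bar> + \<bar>d\<bar>) * (1 + 2 / a)) * exp (- (a/2) * (norm (x - u))\<^sup>2))"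
  proof (intro AE_I2)
    fix x
    define y where "y = norm (x - u)"
    have y: "y \<ge> 0" by (simp add: y_def)
    define E where "E = exp ((a/2) * y\<^sup>2)"
    have E: "E \<ge> 1 + (a/2) * y\<^sup>2" unfolding E_def by (rule exp_ge_add_one_self)
    have "(a / 2) * y\<^sup>2 \<le> E" "1 \<le> E"
      using E mult_nonneg_nonneg[of "a/2" "y\<^sup>2"] a zero_le_power2[of y] by linarith+
    then have "1 + y\<^sup>2 \<le> (1 + 2 / a) * E"
      using a by (simp add: field_simps add_mono)
    moreover have "y \<le> 1 + y\<^sup>2" using sum_squares_ge_zero[of "y - 1/2" 0] by (simp add: power2_eq_square algebra_simps)
    ultimately have b: "y \<le> (1 + 2/a) * E" "1 \<le> (1 + 2/a) * E"
      using zero_le_power2[of y] by linarith+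
    have "\<bar>c + d * y\<bar> \<le> \<bar>c\<bar> * 1 + \<bar>d\<bar> * y"
      using y abs_triangle_ineq[of c "d*y"] by (simp add: abs_mult)
    also have "\<dots> \<le> \<bar>c\<bar> * ((1 + 2/a) * E) + \<bar>d\<bar> * ((1 + 2/a) * E)"
      using b by (intro add_mono mult_left_mono) auto
    finally have "\<bar>c + d * y\<bar> \<le> ((\<bar>c\<bar> + \<bar>d\<bar>) * (1 + 2 / a)) * E"
      by (simp add: distrib_right mult.assoc)
    then have "\<bar>c + d * y\<bar> * exp (- a * y\<^sup>2) \<le> ((\<bar>c\<bar> + \<bar>d\<bar>) * (1 + 2 / a)) * E * exp (- a * y\<^sup>2)"
      by (intro mult_right_mono) auto
    also have "\<dots> = ((\<bar>c\<bar> + \<bar>d\<bar>) * (1 + 2 / a)) * exp (- (a/2) * y\<^sup>2)"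
      by (simp add: E_def mult.assoc flip: exp_add)
    finally have "\<bar>c + d * y\<bar> * exp (- a * y\<^sup>2) \<le> ((\<bar>c\<bar> + \<bar>d\<bar>) * (1 + 2 / a)) * exp (- (a/2) * y\<^sup>2)" .
    then show "norm ((c + d * norm (x - u)) * exp (- a * (norm (x - u))\<^sup>2))
      \<le> norm (((\<bar>c\<bar> + \<bar>d\<bar>) * (1 + 2 / a)) * exp (- (a/2) * (norm (x - u))\<^sup>2))"
      using a by (simp add: y_def abs_mult)
  qed
qed measurable

section \<open>Detailed balance of the kernel\<close>

text \<open>With \<open>A\<close> and \<open>B\<close> the squared distances of the two velocities
  from \<open>u1\<close> and \<open>K = 1 + mu m m1 eps\<close>, the cross term
  \<open>2 * K * (A - B)\<close> of the square and the extra \<open>4 * K * B\<close> add up to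
  \<open>2 * K * (A + B)\<close>, so the whole exponent is symmetric.\<close>

lemma kern_detailed_balance:
  "kern m m1 eps u1 th1 v v' * exp (- (m1 / (2 * th1)) * (1 + mu m m1 eps) * (norm (v' - u1))\<^sup>2)
    = kern m m1 eps u1 th1 v' v * exp (- (m1 / (2 * th1)) * (1 + mu m m1 eps) * (norm (v - u1))\<^sup>2)"
proof (cases "v = v'")
  case False
  define r where "r = norm (v - v')"
  have r: "r \<noteq> 0" "norm (v' - v) = r" using False by (auto simp: r_def norm_minus_commute)
  have expand: "- (m1 / (8 * th1)) * (K * r + (A - B) / r)\<^sup>2 + - (m1 / (2 * th1)) * K * B
      = - (m1 / (8 * th1)) * (K\<^sup>2 * r\<^sup>2 + ((A - B) / r)\<^sup>2 + 2 * K * (A + B))" for K A B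
    \<comment> \<open>For \<open>th1 = 0\<close> division by zero makes both prefactors 0.\<close>
    using r by (cases "th1 = 0") (simp_all add: power2_eq_square field_simps)
  have sym: "((A - B) / r)\<^sup>2 = ((B - A) / r)\<^sup>2" for A B
    by (simp add: power2_commute power_divide)
  show ?thesis
    unfolding kern_def r(2) r_def[symmetric] mult.assoc exp_add[symmetric]
    using expand[of "1 + mu m m1 eps" "(norm (v - u1))\<^sup>2" "(norm (v' - u1))\<^sup>2"]
      expand[of "1 + mu m m1 eps" "(norm (v' - u1))\<^sup>2" "(norm (v - u1))\<^sup>2"]
      sym[of "(norm (v - u1))\<^sup>2" "(norm (v' - u1))\<^sup>2"]
    by (simp add: mult.assoc add.commute)
qed simp

section \<open>Setting and measurability\<close>

locale inelastic_gas =
  fixes m m1 eps th1 :: real and u1 :: vec3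
  assumes m: "m > 0" and m1: "m1 > 0" and eps: "0 < eps" "eps < 1" and th1: "th1 > 0"
begin

abbreviation "g \<equiv> gamma m m1 eps"
abbreviation "g' \<equiv> gammabar m m1 eps"
abbreviation "N v \<equiv> M1 m1 u1 th1 v"
abbreviation "E v \<equiv> Msharp m m1 eps u1 th1 v"
abbreviation "vs \<equiv> vstar m m1 eps"
abbreviation "ws \<equiv> wstar m m1 eps"
abbreviation "sig \<equiv> sigma m1 u1 th1"
abbreviation "Q f \<equiv> Qop m m1 eps u1 th1 f"
abbreviation "P \<equiv> (lborel :: vec3 measure) \<Otimes>\<^sub>M sphere_measure"

definition gain_integrand :: "(vec3 \<Rightarrow> real) \<Rightarrow> vec3 \<Rightarrow> vec3 \<times> vec3 \<Rightarrow> real" where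
  "gain_integrand f v p = \<bar>(v - fst p) \<bullet> snd p\<bar> * f (vs v (fst p) (snd p)) * N (ws v (fst p) (snd p))"

text \<open>Unlike \<open>sigma\<close>, the following integral does not collapse to 0 when it diverges; that the two agree
  needs the moment bound of \<open>nsigma_le_linear\<close>.\<close>
definition nsigma :: "vec3 \<Rightarrow> ennreal" where
  "nsigma v = (\<integral>\<^sup>+p. ennreal (\<bar>(v - fst p) \<bullet> snd p\<bar> * N (fst p)) \<partial>P)"

lemma Qop_eq_gain_integrand: "Q f v = (\<integral>p. gain_integrand f v p \<partial>P) / eps\<^sup>2 - sig v * f v"
  by (simp add: Qop_def Qplus_def gain_integrand_def)

lemma M1_nonneg [simp]: "0 \<le> N v" and M1_pos: "0 < N v"
  using m1 th1 by (simp_all add: M1_def)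

lemma M1_measurable [measurable]: "M1 m1 u1 th1 \<in> borel_measurable borel"
  unfolding M1_def by measurable

lemma Msharp_measurable [measurable]: "Msharp m m1 eps u1 th1 \<in> borel_measurable borel"
  unfolding Msharp_def by measurable

lemma Msharp_nonneg [simp]: "0 \<le> E v"
  by (simp add: Msharp_def)

lemma vstar_measurable [measurable (raw)]:
  assumes [measurable]: "a \<in> borel_measurable M" "b \<in> borel_measurable M" "c \<in> borel_measurable M"
  shows "(\<lambda>x. vs (a x) (b x) (c x)) \<in> borel_measurable M"
  unfolding vstar_def by measurable

lemma wstar_measurable [measurable (raw)]:
  assumes [measurable]: "a \<in> borel_measurable M" "b \<in> borel_measurable M" "c \<in> borel_measurable M"
  shows "(\<lambda>x. ws (a x) (b x) (c x)) \<in> borel_measurable M"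
  unfolding wstar_def by measurable

lemma gain_integrand_measurable [measurable]:
  assumes [measurable]: "f \<in> borel_measurable borel"
  shows "(\<lambda>(v, p). gain_integrand f v p) \<in> borel_measurable (borel \<Otimes>\<^sub>M P)"
    and "gain_integrand f v \<in> borel_measurable P"
  unfolding gain_integrand_def by measurable

lemma sigma_measurable [measurable]: "sig \<in> borel_measurable borel"
  unfolding sigma_def by measurable

lemma nsigma_measurable [measurable]: "nsigma \<in> borel_measurable borel"
  unfolding nsigma_def by measurable

section \<open>Parameter identities and Maxwellians under a collision\<close>

lemma alpha_beta: "0 < alpha m m1" "alpha m m1 < 1" "0 < 1 - beta eps" "1 - beta eps < 1" "1 - 2 * beta eps = eps"
  using m m1 eps by (auto simp: alpha_def beta_def field_simps)

text \<open>This encodes the inverse collision law: the normal component of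
  \<open>vs v w n - ws v w n\<close> is \<open>- 1 / eps\<close> times that of
  \<open>v - w\<close>.\<close>

lemma gamma_sum: "2 * g + 2 * g' = 1 + 1 / eps"
  using eps by (simp add: gamma_def gammabar_def alpha_beta add_divide_distrib[symmetric] algebra_simps)
    (simp add: beta_def field_simps)

lemma gamma_pos: "g > 0"
  using alpha_beta eps by (simp add: gamma_def)

lemma alpha_beta_lt_1: "0 < 1 - alpha m m1 * (1 - beta eps)"
  using mult_strict_mono[of "alpha m m1" 1 "1 - beta eps" 1] alpha_beta by simp

lemma theta_sharp_pos: "theta_sharp m m1 eps th1 > 0"
  using alpha_beta alpha_beta_lt_1 th1 by (simp add: theta_sharp_def)

text \<open>This is the condition that singles out \<open>theta_sharp\<close>: it makes the mixed
  terms in \<open>q \<bullet> n\<close> and \<open>(v - u1) \<bullet> n\<close> agree in the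
  exponents of \<open>Msharp_M1_collision\<close>.\<close>

lemma theta_sharp_balance:
  "m / (2 * theta_sharp m m1 eps th1) * (2 * g) = m1 / (2 * th1) * (2 * g' + (1 / eps - 1))"
proof -
  have "m / (1 - alpha m m1) = m1 / alpha m m1"
    using m m1 by (simp add: alpha_def field_simps)
  moreover have "m / theta_sharp m m1 eps th1 =
    (m / (1 - alpha m m1)) * (1 - alpha m m1 * (1 - beta eps)) / ((1 - beta eps) * th1)"
    by (simp add: theta_sharp_def)
  ultimately have "m / theta_sharp m m1 eps th1 * (2 * g) = m1 / th1 * (2 * (1 - alpha m m1 * (1 - beta eps)) / eps)"
    using alpha_beta(1,3) by (simp add: gamma_def alpha_beta(5)) (auto simp: divide_simps algebra_simps)
  also have "2 * (1 - alpha m m1 * (1 - beta eps)) / eps = 2 * g' + (1 / eps - 1)"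
    using eps by (simp add: gammabar_def alpha_beta(5) field_simps) (simp add: beta_def field_simps)
  finally have "m / theta_sharp m m1 eps th1 * (2 * g) / 2 = m1 / th1 * (2 * g' + (1 / eps - 1)) / 2"
    by simp
  then show ?thesis by (simp add: mult.commute)
qed

text \<open>The prefactors agree, so only the exponents matter. Beyond their common terms these are
  combinations of \<open>s * (z \<bullet> n)\<close> and \<open>s\<^sup>2\<close>. The coefficients
  of the former match by \<open>E1\<close>, those of the latter by \<open>E3\<close>, which is the
  product of \<open>E1\<close> and \<open>E2\<close>.\<close>

lemma Msharp_M1_collision:
  assumes n: "norm n = 1"
  shows "E (vs v (v - q) n) * N (ws v (v - q) n) = E v * N (v - (q + ((1 / eps - 1) * (q \<bullet> n)) *\<^sub>R n))"
proof -
  define a where "a = m / (2 * theta_sharp m m1 eps th1)"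
  define b where "b = m1 / (2 * th1)"
  define z where "z = v - u1"
  define s where "s = q \<bullet> n"
  define k where "k = 1 / eps - 1"
  have nn: "n \<bullet> n = 1" using n by (simp add: norm_eq_1)
  have E1: "a * (2 * g) = b * (2 * g' + k)"
    using theta_sharp_balance by (simp add: a_def b_def k_def)
  have E2: "2 * g = k + 2 - 2 * g'" using gamma_sum by (simp add: k_def)
  have sq: "(norm (y + t *\<^sub>R n))\<^sup>2 = (norm y)\<^sup>2 + 2 * t * (y \<bullet> n) + t\<^sup>2" for y t
    by (simp add: power2_norm_eq_inner inner_add_left inner_add_right nn inner_commute)
       (simp add: power2_eq_square algebra_simps)
  have 1: "(norm (vs v (v - q) n - u1))\<^sup>2 = (norm z)\<^sup>2 - 4 * g * s * (z \<bullet> n) + 4 * g\<^sup>2 * s\<^sup>2"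
    using sq[of z "- (2 * g * s)"] by (simp add: vstar_def z_def s_def power_mult_distrib algebra_simps)
  have 2: "(norm (ws v (v - q) n - u1))\<^sup>2 = (norm (z - q))\<^sup>2 + 4 * g' * s * (z \<bullet> n - s) + 4 * g'\<^sup>2 * s\<^sup>2"
    using sq[of "z - q" "2 * g' * s"]
    by (simp add: wstar_def z_def s_def power_mult_distrib inner_diff_left algebra_simps)
  have 3: "(norm (v - (q + (k * s) *\<^sub>R n) - u1))\<^sup>2 = (norm (z - q))\<^sup>2 - 2 * k * s * (z \<bullet> n - s) + k\<^sup>2 * s\<^sup>2"
    using sq[of "z - q" "- (k * s)"]
    by (simp add: z_def s_def power_mult_distrib inner_diff_left algebra_simps)
  have "a * (2 * g) * (2 * g) = b * (2 * g' + k) * (k + 2 - 2 * g')"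
    by (rule arg_cong2[where f = times, OF E1 E2])
  then have E3: "a * (4 * g\<^sup>2) = b * (4 * g' + k\<^sup>2 + 2 * k - 4 * g'\<^sup>2)"
    by (simp add: power2_eq_square algebra_simps)
  have "a * (norm (vs v (v - q) n - u1))\<^sup>2 + b * (norm (ws v (v - q) n - u1))\<^sup>2
    = a * (norm z)\<^sup>2 - (a * (2 * g)) * (2 * s * (z \<bullet> n)) + (a * (4 * g\<^sup>2)) * s\<^sup>2
      + b * ((norm (z - q))\<^sup>2 + 4 * g' * s * (z \<bullet> n - s) + 4 * g'\<^sup>2 * s\<^sup>2)"
    unfolding 1 2 by (simp add: algebra_simps)
  also have "\<dots> = a * (norm (v - u1))\<^sup>2 + b * (norm (v - (q + (k * s) *\<^sub>R n) - u1))\<^sup>2"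
    unfolding E1 E3 3 z_def[symmetric] by (simp add: power2_eq_square algebra_simps)
  finally have *: "a * (norm (vs v (v - q) n - u1))\<^sup>2 + b * (norm (ws v (v - q) n - u1))\<^sup>2
      = a * (norm (v - u1))\<^sup>2 + b * (norm (v - (q + (k * s) *\<^sub>R n) - u1))\<^sup>2" .
  have exps: "exp (- (m * x) / (2 * theta_sharp m m1 eps th1)) * exp (- (m1 * y) / (2 * th1)) = exp (- (a * x + b * y))" for x y
    by (simp add: a_def b_def flip: exp_add)
  have "exp (- (m * (norm (vs v (v - q) n - u1))\<^sup>2) / (2 * theta_sharp m m1 eps th1)) * exp (- (m1 * (norm (ws v (v - q) n - u1))\<^sup>2) / (2 * th1))
    = exp (- (m * (norm (v - u1))\<^sup>2) / (2 * theta_sharp m m1 eps th1)) * exp (- (m1 * (norm (v - (q + (k * s) *\<^sub>R n) - u1))\<^sup>2) / (2 * th1))"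
    unfolding exps * ..
  then show ?thesis
    unfolding Msharp_def M1_def k_def[symmetric] s_def[symmetric] by (simp add: mult_ac)
qed

section \<open>Gain and loss integrals\<close>

lemma nsigma_eq: "nsigma v = (\<integral>\<^sup>+n. \<integral>\<^sup>+q. ennreal \<bar>q \<bullet> n\<bar> * ennreal (N (v - q)) \<partial>lborel \<partial>sphere_measure)"
proof -
  have "nsigma v = (\<integral>\<^sup>+n. \<integral>\<^sup>+w. ennreal (\<bar>(v - w) \<bullet> n\<bar> * N w) \<partial>lborel \<partial>sphere_measure)"
    unfolding nsigma_def by (subst sphere.nn_integral_snd[symmetric]) simp_all
  also have "\<dots> = (\<integral>\<^sup>+n. \<integral>\<^sup>+q. ennreal \<bar>q \<bullet> n\<bar> * ennreal (N (v - q)) \<partial>lborel \<partial>sphere_measure)"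
    by (rule nn_integral_cong, subst nn_integral_lborel_reflect[of _ v]) (simp_all add: ennreal_mult)
  finally show ?thesis .
qed

text \<open>For fixed \<open>n\<close> the collision identity pulls \<open>E v\<close> out of the
  integral over \<open>q\<close>, and the stretching by \<open>1 / eps\<close> costs
  \<open>eps\<^sup>2\<close>.\<close>

lemma nn_integral_gain_Msharp:
  "(\<integral>\<^sup>+p. ennreal (gain_integrand E v p) \<partial>P) = ennreal (eps\<^sup>2 * E v) * nsigma v"
proof -
  have "(\<integral>\<^sup>+p. ennreal (gain_integrand E v p) \<partial>P)
     = (\<integral>\<^sup>+n. \<integral>\<^sup>+w. ennreal (gain_integrand E v (w, n)) \<partial>lborel \<partial>sphere_measure)"
    by (subst sphere.nn_integral_snd) auto
  also have "\<dots> = (\<integral>\<^sup>+n. ennreal (eps\<^sup>2 * E v) * (\<integral>\<^sup>+q. ennreal \<bar>q \<bullet> n\<bar> * ennreal (N (v - q)) \<partial>lborel) \<partial>sphere_measure)"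
  proof (rule nn_integral_cong_AE, use AE_sphere_norm in eventually_elim)
    case (elim n)
    have "(\<integral>\<^sup>+w. ennreal (gain_integrand E v (w, n)) \<partial>lborel) = (\<integral>\<^sup>+q. ennreal (gain_integrand E v (v - q, n)) \<partial>lborel)"
      by (rule nn_integral_lborel_reflect) (simp add: gain_integrand_def, measurable)
    also have "\<dots> = (\<integral>\<^sup>+q. ennreal (E v) * (ennreal \<bar>q \<bullet> n\<bar> * ennreal (N (v - (q + ((1 / eps - 1) * (q \<bullet> n)) *\<^sub>R n)))) \<partial>lborel)"
      using Msharp_M1_collision[OF elim, of v]
      by (intro nn_integral_cong) (simp add: gain_integrand_def mult.assoc mult.left_commute flip: ennreal_mult)
    also have "\<dots> = ennreal (E v) * (ennreal (1 / (1/eps)\<^sup>2) * (\<integral>\<^sup>+q. ennreal \<bar>q \<bullet> n\<bar> * ennreal (N (v - q)) \<partial>lborel))"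
      using eps by (subst nn_integral_cmult, measurable, subst nn_integral_rank_one_weighted[OF elim]) auto
    finally show ?case
      using eps by (simp add: power_divide ennreal_mult mult_ac)
  qed
  also have "\<dots> = ennreal (eps\<^sup>2 * E v) * nsigma v"
    unfolding nsigma_eq by (rule nn_integral_cmult) measurable
  finally show ?thesis .
qed

text \<open>Conservation of mass. For fixed \<open>q\<close> and \<open>n\<close>, a translation of
  \<open>v\<close> moves the argument of \<open>h\<close> back to \<open>v\<close>; a rank-one
  substitution in \<open>q\<close> then restores the loss integral.\<close>

lemma nn_integral_gain:
  assumes [measurable]: "h \<in> borel_measurable borel"
  shows "(\<integral>\<^sup>+v. \<integral>\<^sup>+p. ennreal \<bar>gain_integrand h v p\<bar> \<partial>P \<partial>lborel)
     = ennreal (eps\<^sup>2) * (\<integral>\<^sup>+v. ennreal \<bar>h v\<bar> * nsigma v \<partial>lborel)"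
proof -
  have "(\<integral>\<^sup>+v. \<integral>\<^sup>+p. ennreal \<bar>gain_integrand h v p\<bar> \<partial>P \<partial>lborel)
     = (\<integral>\<^sup>+v. \<integral>\<^sup>+n. \<integral>\<^sup>+w. ennreal \<bar>gain_integrand h v (w, n)\<bar> \<partial>lborel \<partial>sphere_measure \<partial>lborel)"
    by (subst sphere.nn_integral_snd) auto
  also have "\<dots> = (\<integral>\<^sup>+n. \<integral>\<^sup>+v. \<integral>\<^sup>+w. ennreal \<bar>gain_integrand h v (w, n)\<bar> \<partial>lborel \<partial>lborel \<partial>sphere_measure)"
    by (rule sphere.Fubini'[symmetric]) measurable
  also have "\<dots> = (\<integral>\<^sup>+n. ennreal (eps\<^sup>2) * (\<integral>\<^sup>+v. ennreal \<bar>h v\<bar> * (\<integral>\<^sup>+q. ennreal \<bar>q \<bullet> n\<bar> * ennreal (N (v - q)) \<partial>lborel) \<partial>lborel) \<partial>sphere_measure)"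
  proof (rule nn_integral_cong_AE, use AE_sphere_norm in eventually_elim)
    case (elim n)
    have "(\<integral>\<^sup>+v. \<integral>\<^sup>+w. ennreal \<bar>gain_integrand h v (w, n)\<bar> \<partial>lborel \<partial>lborel)
      = (\<integral>\<^sup>+v. \<integral>\<^sup>+q. ennreal \<bar>gain_integrand h v (v - q, n)\<bar> \<partial>lborel \<partial>lborel)"
      by (intro nn_integral_cong nn_integral_lborel_reflect) (simp add: gain_integrand_def, measurable)
    also have "\<dots> = (\<integral>\<^sup>+v. \<integral>\<^sup>+q. ennreal \<bar>q \<bullet> n\<bar> * (ennreal \<bar>h (v - (2 * g * (q \<bullet> n)) *\<^sub>R n)\<bar>
         * ennreal (N (v - q + (2 * g' * (q \<bullet> n)) *\<^sub>R n))) \<partial>lborel \<partial>lborel)"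
      by (intro nn_integral_cong) (simp add: gain_integrand_def vstar_def wstar_def abs_mult mult.assoc flip: ennreal_mult)
    also have "\<dots> = (\<integral>\<^sup>+q. \<integral>\<^sup>+v. ennreal \<bar>q \<bullet> n\<bar> * (ennreal \<bar>h (v - (2 * g * (q \<bullet> n)) *\<^sub>R n)\<bar>
         * ennreal (N (v - q + (2 * g' * (q \<bullet> n)) *\<^sub>R n))) \<partial>lborel \<partial>lborel)"
      by (rule lborel_pair.Fubini'[symmetric]) measurable
    also have "\<dots> = (\<integral>\<^sup>+q. \<integral>\<^sup>+v. ennreal \<bar>q \<bullet> n\<bar> * (ennreal \<bar>h v\<bar>
         * ennreal (N (v - (q + ((- 1 / eps - 1) * (q \<bullet> n)) *\<^sub>R n)))) \<partial>lborel \<partial>lborel)"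
    proof (rule nn_integral_cong)
      fix q :: vec3
      \<comment> \<open>Translating by \<open>2 * g * (q \<bullet> n)\<close> along \<open>n\<close>
        adds this shift to the one in the argument of \<open>N\<close>. By \<open>gamma_sum\<close>
        the total is that of the rank-one map with factor \<open>- 1 / eps\<close>.\<close>
      have c: "- 1 / eps - 1 = - (2 * g + 2 * g')" using gamma_sum by simp
      show "(\<integral>\<^sup>+v. ennreal \<bar>q \<bullet> n\<bar> * (ennreal \<bar>h (v - (2 * g * (q \<bullet> n)) *\<^sub>R n)\<bar>
         * ennreal (N (v - q + (2 * g' * (q \<bullet> n)) *\<^sub>R n))) \<partial>lborel) = (\<integral>\<^sup>+v. ennreal \<bar>q \<bullet> n\<bar> * (ennreal \<bar>h v\<bar>
         * ennreal (N (v - (q + ((- 1 / eps - 1) * (q \<bullet> n)) *\<^sub>R n)))) \<partial>lborel)"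
        unfolding c
        by (subst nn_integral_lborel_translate[of _ "(2 * g * (q \<bullet> n)) *\<^sub>R n"], measurable)
           (simp add: algebra_simps)
    qed
    also have "\<dots> = (\<integral>\<^sup>+v. \<integral>\<^sup>+q. ennreal \<bar>q \<bullet> n\<bar> * (ennreal \<bar>h v\<bar>
         * ennreal (N (v - (q + ((- 1 / eps - 1) * (q \<bullet> n)) *\<^sub>R n)))) \<partial>lborel \<partial>lborel)"
      by (rule lborel_pair.Fubini') measurable
    also have "\<dots> = (\<integral>\<^sup>+v. ennreal \<bar>h v\<bar> * (ennreal (eps\<^sup>2) * (\<integral>\<^sup>+q. ennreal \<bar>q \<bullet> n\<bar> * ennreal (N (v - q)) \<partial>lborel)) \<partial>lborel)"
    proof (rule nn_integral_cong)
      fix v :: vec3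
      have "(\<integral>\<^sup>+q. ennreal \<bar>q \<bullet> n\<bar> * (ennreal \<bar>h v\<bar>
         * ennreal (N (v - (q + ((- 1 / eps - 1) * (q \<bullet> n)) *\<^sub>R n)))) \<partial>lborel)
        = ennreal \<bar>h v\<bar> * (\<integral>\<^sup>+q. ennreal \<bar>q \<bullet> n\<bar> * ennreal (N (v - (q + ((- 1 / eps - 1) * (q \<bullet> n)) *\<^sub>R n))) \<partial>lborel)"
        by (subst nn_integral_cmult[symmetric]) (measurable, simp add: mult_ac)
      also have "\<dots> = ennreal \<bar>h v\<bar> * (ennreal (eps\<^sup>2) * (\<integral>\<^sup>+q. ennreal \<bar>q \<bullet> n\<bar> * ennreal (N (v - q)) \<partial>lborel))"
        using eps by (subst nn_integral_rank_one_weighted[OF elim]) (auto simp: power_divide)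
      finally show "(\<integral>\<^sup>+q. ennreal \<bar>q \<bullet> n\<bar> * (ennreal \<bar>h v\<bar>
         * ennreal (N (v - (q + ((- 1 / eps - 1) * (q \<bullet> n)) *\<^sub>R n)))) \<partial>lborel) = 
         ennreal \<bar>h v\<bar> * (ennreal (eps\<^sup>2) * (\<integral>\<^sup>+q. ennreal \<bar>q \<bullet> n\<bar> * ennreal (N (v - q)) \<partial>lborel))" .
    qed
    also have "\<dots> = ennreal (eps\<^sup>2) * (\<integral>\<^sup>+v. ennreal \<bar>h v\<bar> * (\<integral>\<^sup>+q. ennreal \<bar>q \<bullet> n\<bar> * ennreal (N (v - q)) \<partial>lborel) \<partial>lborel)"
      by (subst nn_integral_cmult[symmetric]) (measurable, simp add: mult_ac)
    finally show ?case .
  qed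
  also have "\<dots> = ennreal (eps\<^sup>2) * (\<integral>\<^sup>+n. \<integral>\<^sup>+v. ennreal \<bar>h v\<bar> * (\<integral>\<^sup>+q. ennreal \<bar>q \<bullet> n\<bar> * ennreal (N (v - q)) \<partial>lborel) \<partial>lborel \<partial>sphere_measure)"
    by (rule nn_integral_cmult) measurable
  also have "(\<integral>\<^sup>+n. \<integral>\<^sup>+v. ennreal \<bar>h v\<bar> * (\<integral>\<^sup>+q. ennreal \<bar>q \<bullet> n\<bar> * ennreal (N (v - q)) \<partial>lborel) \<partial>lborel \<partial>sphere_measure)
     = (\<integral>\<^sup>+v. \<integral>\<^sup>+n. ennreal \<bar>h v\<bar> * (\<integral>\<^sup>+q. ennreal \<bar>q \<bullet> n\<bar> * ennreal (N (v - q)) \<partial>lborel) \<partial>sphere_measure \<partial>lborel)"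
    by (rule sphere.Fubini') measurable
  also have "\<dots> = (\<integral>\<^sup>+v. ennreal \<bar>h v\<bar> * nsigma v \<partial>lborel)"
    unfolding nsigma_eq by (intro nn_integral_cong nn_integral_cmult) measurable
  finally show ?thesis .
qed

section \<open>Normalisation and growth of the collision frequency\<close>

lemma integrable_linear_times_M1: "integrable lborel (\<lambda>x. (c + d * norm (x - u1)) * N x)"
proof -
  have "integrable lborel (\<lambda>x. (m1 / (2 * pi * th1)) powr (3/2) * ((c + d * norm (x - u1)) * exp (- (m1 / (2 * th1)) * (norm (x - u1))\<^sup>2)))"
    using m1 th1 by (intro integrable_mult_right integrable_linear_times_gaussian) simp
  then show ?thesis by (simp add: M1_def mult_ac)
qed

lemma integrable_linear_times_Msharp: "integrable lborel (\<lambda>x. (c + d * norm (x - u1)) * E x)"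
proof -
  have "integrable lborel (\<lambda>x. (m / (2 * pi * theta_sharp m m1 eps th1)) powr (3/2)
      * ((c + d * norm (x - u1)) * exp (- (m / (2 * theta_sharp m m1 eps th1)) * (norm (x - u1))\<^sup>2)))"
    using m theta_sharp_pos by (intro integrable_mult_right integrable_linear_times_gaussian) simp
  then show ?thesis by (simp add: Msharp_def mult_ac)
qed

lemma integral_Msharp: "(\<integral>v. E v \<partial>lborel) = 1"
proof -
  define a where "a = m / (2 * theta_sharp m m1 eps th1)"
  have a: "a > 0" using m theta_sharp_pos by (simp add: a_def)
  have *: "E v = (a / pi) powr (3/2) * exp (- a * (norm (v - u1))\<^sup>2)" for v
    by (simp add: Msharp_def a_def mult_ac)
  have "(\<integral>\<^sup>+v. ennreal (E v) \<partial>lborel) = ennreal ((a / pi) powr (3/2)) * ennreal ((pi / a) powr (3/2))"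
    unfolding * nn_integral_gaussian[OF a, of u1, symmetric]
    by (subst nn_integral_cmult[symmetric]) (simp_all add: ennreal_mult)
  also have "\<dots> = 1"
    using a by (simp flip: ennreal_mult powr_mult)
  finally show ?thesis
    by (subst integral_eq_nn_integral) auto
qed

text \<open>For unit \<open>n\<close>, \<open>\<bar>(v - w) \<bullet> n\<bar>\<close> is at most
  \<open>norm (v - u1) + norm (w - u1)\<close>, and \<open>N\<close> has finite zeroth and first
  moments. The bound gives both the finiteness of \<open>nsigma\<close> and the integrability of
  \<open>sig\<close> against the Maxwellian.\<close>

lemma nsigma_le_linear: obtains A B where "A \<ge> 0" "B \<ge> 0" "\<And>v. nsigma v \<le> ennreal (A + B * norm (v - u1))"
proof -
  define S where "S = measure sphere_measure UNIV"
  have S: "emeasure sphere_measure UNIV = ennreal S" "S \<ge> 0" by (simp_all add: S_def sphere_measure.emeasure_eq_measure)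
  define I where "I c d = (\<integral>x. (c + d * norm (x - u1)) * N x \<partial>lborel)" for c d
  have "nsigma v \<le> ennreal (S * I 0 1 + S * I 1 0 * norm (v - u1))" for v
  proof -
    have "nsigma v = (\<integral>\<^sup>+w. \<integral>\<^sup>+n. ennreal (\<bar>(v - w) \<bullet> n\<bar> * N w) \<partial>sphere_measure \<partial>lborel)"
      unfolding nsigma_def by (subst sphere_measure.nn_integral_fst[symmetric]) simp_all
    \<comment> \<open>The factor \<open>1 *\<close> puts the integrand into the form of
      \<open>I c d\<close>.\<close>
    also have "\<dots> \<le> (\<integral>\<^sup>+w. \<integral>\<^sup>+n. ennreal ((norm (v - u1) + 1 * norm (w - u1)) * N w) \<partial>sphere_measure \<partial>lborel)"
    proof (rule nn_integral_mono, rule nn_integral_mono_AE, use AE_sphere_norm in eventually_elim)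
      fix w n :: vec3
      assume elim: "norm n = 1"
      have "\<bar>(v - w) \<bullet> n\<bar> \<le> norm (v - w)" using Cauchy_Schwarz_ineq2[of "v - w" n] elim by simp
      also have "\<dots> \<le> norm (v - u1) + norm (w - u1)" using norm_triangle_ineq4[of "v - u1" "w - u1"] by simp
      finally show "ennreal (\<bar>(v - w) \<bullet> n\<bar> * N w) \<le> ennreal ((norm (v - u1) + 1 * norm (w - u1)) * N w)"
        by (intro ennreal_leI mult_right_mono) auto
    qed
    also have "\<dots> = ennreal S * (\<integral>\<^sup>+w. ennreal ((norm (v - u1) + 1 * norm (w - u1)) * N w) \<partial>lborel)"
      by (subst nn_integral_cmult[symmetric]) (simp_all add: S mult.commute)
    also have "\<dots> = ennreal S * ennreal (I (norm (v - u1)) 1)"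
      unfolding I_def by (subst nn_integral_eq_integral[OF integrable_linear_times_M1]) (auto intro!: mult_nonneg_nonneg)
    also have "I (norm (v - u1)) 1 = norm (v - u1) * I 1 0 + I 0 1"
      unfolding I_def using integrable_linear_times_M1[of 1 0] integrable_linear_times_M1[of 0 1]
      by (simp add: distrib_right)
    finally show ?thesis using S by (simp add: algebra_simps flip: ennreal_mult')
  qed
  moreover have "I 0 1 \<ge> 0" "I 1 0 \<ge> 0" by (simp_all add: I_def)
  ultimately show ?thesis using S by (intro that[of "S * I 0 1" "S * I 1 0"]) auto
qed

lemma sigma_nonneg [simp]: "0 \<le> sig v"
  by (simp add: sigma_def)

lemma nsigma_eq_sigma: "nsigma v = ennreal (sig v)"
proof -
  have "nsigma v < top"
    by (rule nsigma_le_linear) (meson ennreal_less_top le_less_trans)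
  moreover have "sig v = enn2real (nsigma v)"
    unfolding sigma_def nsigma_def by (rule integral_eq_nn_integral) auto
  ultimately show ?thesis by simp
qed

lemma integrable_sigma_Msharp: "integrable lborel (\<lambda>v. sig v * E v)"
proof -
  obtain A B where AB: "A \<ge> 0" "B \<ge> 0" "\<And>v. nsigma v \<le> ennreal (A + B * norm (v - u1))"
    by (rule nsigma_le_linear) blast
  have "sig v \<le> A + B * norm (v - u1)" for v
    using AB(3)[of v] AB(1,2) by (simp add: nsigma_eq_sigma del: ennreal_plus)
  then show ?thesis
    by (intro Bochner_Integration.integrable_bound[OF integrable_linear_times_Msharp[of A B]] AE_I2)
       (use AB in \<open>auto simp: abs_mult intro!: mult_right_mono\<close>)
qed

section \<open>Stationarity of the Maxwellian\<close>

lemma Qop_Msharp: "Q (Msharp m m1 eps u1 th1) v = 0"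
proof -
  have "(\<integral>p. gain_integrand E v p \<partial>P) = enn2real (\<integral>\<^sup>+p. ennreal (gain_integrand E v p) \<partial>P)"
    by (rule integral_eq_nn_integral) (auto simp: gain_integrand_def)
  also have "\<dots> = eps\<^sup>2 * E v * sig v"
    by (simp add: nn_integral_gain_Msharp nsigma_eq_sigma enn2real_mult)
  finally show ?thesis
    using eps by (simp add: Qop_eq_gain_integrand)
qed

section \<open>Uniqueness of the equilibrium\<close>

lemma nn_integral_gain_finite:
  assumes [measurable]: "f \<in> borel_measurable borel" and int: "integrable lborel (\<lambda>v. sig v * f v)"
  shows "(\<integral>\<^sup>+v. \<integral>\<^sup>+p. ennreal \<bar>gain_integrand f v p\<bar> \<partial>P \<partial>lborel) = (\<integral>\<^sup>+v. ennreal (eps\<^sup>2 * (sig v * \<bar>f v\<bar>)) \<partial>lborel)"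
    and "(\<integral>\<^sup>+v. ennreal (eps\<^sup>2 * (sig v * \<bar>f v\<bar>)) \<partial>lborel) < \<infinity>"
proof -
  have eq: "(\<integral>\<^sup>+v. ennreal (eps\<^sup>2 * (sig v * \<bar>f v\<bar>)) \<partial>lborel) = ennreal (eps\<^sup>2) * (\<integral>\<^sup>+v. ennreal (sig v * \<bar>f v\<bar>) \<partial>lborel)"
    by (subst nn_integral_cmult[symmetric]) (auto simp: ennreal_mult)
  then show "(\<integral>\<^sup>+v. \<integral>\<^sup>+p. ennreal \<bar>gain_integrand f v p\<bar> \<partial>P \<partial>lborel) = (\<integral>\<^sup>+v. ennreal (eps\<^sup>2 * (sig v * \<bar>f v\<bar>)) \<partial>lborel)"
    by (simp add: nn_integral_gain nsigma_eq_sigma ennreal_mult mult.commute)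
  show "(\<integral>\<^sup>+v. ennreal (eps\<^sup>2 * (sig v * \<bar>f v\<bar>)) \<partial>lborel) < \<infinity>"
    using int unfolding eq by (simp add: integrable_iff_bounded abs_mult ennreal_mult_less_top)
qed

text \<open>A finite iterated integral has a finite inner integral almost everywhere. For such
  \<open>v\<close> the gain integral is not a default value 0, so linearity and the triangle
  inequality apply to it.\<close>

lemma AE_integrable_gain:
  assumes [measurable]: "f \<in> borel_measurable borel" and int: "integrable lborel (\<lambda>v. sig v * f v)"
  shows "AE v in lborel. integrable P (gain_integrand f v)"
proof -
  have "AE v in lborel. (\<integral>\<^sup>+p. ennreal \<bar>gain_integrand f v p\<bar> \<partial>P) \<noteq> \<infinity>"
    using nn_integral_gain_finite[OF assms] by (intro nn_integral_PInf_AE) auto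
  then show ?thesis
    by eventually_elim (auto simp: integrable_iff_bounded less_top)
qed

lemma equilibrium_constant_sign:
  assumes f[measurable]: "f \<in> borel_measurable borel" and int: "integrable lborel (\<lambda>v. sig v * f v)"
    and Q0: "AE v in lborel. Q f v = 0"
  shows "(AE v in lborel. f v \<ge> 0) \<or> (AE v in lborel. f v \<le> 0)"
proof -
  let ?F = "gain_integrand f"
  \<comment> \<open>\<open>L\<close> is the loss of \<open>\<bar>f\<bar>\<close> and
    \<open>H\<close> its gain, both without the prefactor \<open>1 / eps\<^sup>2\<close>.\<close>
  define L where "L v = ennreal (eps\<^sup>2 * (sig v * \<bar>f v\<bar>))" for v
  define H where "H v = (\<integral>\<^sup>+p. ennreal \<bar>?F v p\<bar> \<partial>P)" for v
  have [measurable]: "L \<in> borel_measurable borel" "H \<in> borel_measurable borel"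
    unfolding L_def H_def by measurable
  have Leq: "AE v in lborel. L v = ennreal \<bar>\<integral>p. ?F v p \<partial>P\<bar>"
    using Q0
  proof eventually_elim
    case (elim v)
    then have "(\<integral>p. ?F v p \<partial>P) = eps\<^sup>2 * (sig v * f v)"
      using eps by (simp add: Qop_eq_gain_integrand field_simps)
    then show ?case by (simp add: L_def abs_mult)
  qed
  then have "AE v in lborel. L v \<le> H v"
    using AE_integrable_gain[OF f int]
    by eventually_elim (use integral_norm_bound_ennreal in \<open>force simp: H_def\<close>)
  moreover have "integral\<^sup>N lborel H = integral\<^sup>N lborel L" "integral\<^sup>N lborel L < \<infinity>"
    using nn_integral_gain_finite[OF f int] by (simp_all add: H_def[abs_def] L_def[abs_def])
  \<comment> \<open>The integral of \<open>L\<close> is finite, so the equal integrals may be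
    subtracted.\<close>
  ultimately have "(\<integral>\<^sup>+v. H v - L v \<partial>lborel) = 0"
    by (subst nn_integral_diff) auto
  \<comment> \<open>Subtraction in \<open>ennreal\<close> truncates at 0, so this says
    \<open>H v \<le> L v\<close>, the converse of the triangle inequality.\<close>
  then have "AE v in lborel. H v - L v = 0"
    by (subst (asm) nn_integral_0_iff_AE) auto
  then have "AE v in lborel. integrable P (?F v) \<and> (\<integral>p. \<bar>?F v p\<bar> \<partial>P) \<le> \<bar>\<integral>p. ?F v p \<partial>P\<bar>"
    using Leq AE_integrable_gain[OF f int]
  proof eventually_elim
    case (elim v)
    have "H v = ennreal (\<integral>p. \<bar>?F v p\<bar> \<partial>P)"
      unfolding H_def using elim(3) by (intro nn_integral_eq_integral) auto
    moreover have "H v \<le> L v"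
      using elim(1) by (simp add: L_def diff_eq_0_iff_ennreal)
    ultimately show ?case using elim by simp
  qed
  then obtain v where v: "integrable P (?F v)" "(\<integral>p. \<bar>?F v p\<bar> \<partial>P) \<le> \<bar>\<integral>p. ?F v p \<partial>P\<bar>"
    by (rule AE_lborel_obtain) blast
  \<comment> \<open>Here \<open>s\<close> is the sign of the integral of \<open>?F v\<close>. The
    function \<open>\<bar>?F v p\<bar> - s * ?F v p\<close> is nonnegative with integral 0, so
    \<open>?F v\<close> has sign \<open>s\<close> almost everywhere.\<close>
  have sign: "AE y in lborel. 0 \<le> s * f y" if s: "s = 1 \<or> s = -1" "\<bar>\<integral>p. ?F v p \<partial>P\<bar> = s * (\<integral>p. ?F v p \<partial>P)" for s :: real
  proof -
    have i: "integrable P (\<lambda>p. \<bar>?F v p\<bar> - s * ?F v p)" using v(1) by auto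
    have nn: "0 \<le> \<bar>?F v p\<bar> - s * ?F v p" for p using s(1) by auto
    have "(\<integral>p. \<bar>?F v p\<bar> - s * ?F v p \<partial>P) \<le> 0"
      using v s(2) by simp
    moreover have "(\<integral>p. \<bar>?F v p\<bar> - s * ?F v p \<partial>P) \<ge> 0" using nn by simp
    ultimately have "AE p in P. \<bar>?F v p\<bar> - s * ?F v p = 0"
      using integral_nonneg_eq_0_iff_AE[OF i] nn by auto
    \<comment> \<open>Excluding the single point \<open>v\<close> takes care of grazing collisions: \<open>q \<bullet> n = 0\<close> implies \<open>v\<^sub>\<star> = v\<close>.\<close>
    then have "AE p in P. (\<lambda>y. y \<noteq> v \<longrightarrow> 0 \<le> s * f y) (v - (2 * g * ((v - fst p) \<bullet> snd p)) *\<^sub>R snd p)"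
    proof eventually_elim
      case (elim p)
      let ?c = "\<bar>(v - fst p) \<bullet> snd p\<bar> * N (ws v (fst p) (snd p))"
      have F: "s * ?F v p = ?c * (s * f (vs v (fst p) (snd p)))" by (simp add: gain_integrand_def)
      show ?case
      proof (intro impI)
        assume "v - (2 * g * ((v - fst p) \<bullet> snd p)) *\<^sub>R snd p \<noteq> v"
        then have "?c > 0" using M1_pos by auto
        moreover have "0 \<le> s * ?F v p" using elim by linarith
        ultimately have "0 \<le> s * f (vs v (fst p) (snd p))"
          unfolding F using zero_le_mult_iff[of ?c] by auto
        then show "0 \<le> s * f (v - (2 * g * ((v - fst p) \<bullet> snd p)) *\<^sub>R snd p)" by (simp add: vstar_def)
      qed
    qed
    then have "AE y in lborel. y \<noteq> v \<longrightarrow> 0 \<le> s * f y"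
      using gamma_pos by (intro AE_collision_rays[where k = "2 * g" and v = v]) auto
    then show ?thesis using AE_lborel_singleton[of v] by eventually_elim auto
  qed
  show ?thesis
  proof (cases "(\<integral>p. ?F v p \<partial>P) \<ge> 0")
    case True
    with sign[of 1] show ?thesis by simp
  next
    case False
    with sign[of "-1"] show ?thesis by simp
  qed
qed

lemma equilibrium_unique:
  assumes f[measurable]: "f \<in> borel_measurable borel"
    and int: "integrable lborel f" "integrable lborel (\<lambda>v. sig v * f v)"
    and Q0: "AE v in lborel. Q f v = 0" and mass: "(\<integral>v. f v \<partial>lborel) = 1"
  shows "AE v in lborel. f v = E v"
proof -
  define h where "h v = f v - E v" for v
  have [measurable]: "h \<in> borel_measurable borel" unfolding h_def by measurable
  have E: "integrable lborel E" using integrable_linear_times_Msharp[of 1 0] by simp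
  have h: "integrable lborel h" "integrable lborel (\<lambda>v. sig v * h v)" "(\<integral>v. h v \<partial>lborel) = 0"
    using int E integrable_sigma_Msharp mass integral_Msharp by (auto simp: h_def[abs_def] right_diff_distrib)
  \<comment> \<open>Linearity of \<open>Q\<close> is available only where both gain integrands are
    integrable, that is, for almost every \<open>v\<close>.\<close>
  have "AE v in lborel. Q h v = 0"
    using Q0 AE_integrable_gain[OF f int(2)] AE_integrable_gain[OF Msharp_measurable integrable_sigma_Msharp]
  proof eventually_elim
    case (elim v)
    have "(\<integral>p. gain_integrand h v p \<partial>P) = (\<integral>p. gain_integrand f v p - gain_integrand E v p \<partial>P)"
      by (simp add: gain_integrand_def h_def algebra_simps)
    also have "\<dots> = (\<integral>p. gain_integrand f v p \<partial>P) - (\<integral>p. gain_integrand E v p \<partial>P)"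
      using elim by simp
    finally have "Q h v = Q f v - Q E v"
      by (simp add: Qop_eq_gain_integrand h_def right_diff_distrib diff_divide_distrib)
    then show ?case using elim Qop_Msharp by simp
  qed
  then have "(AE v in lborel. h v \<ge> 0) \<or> (AE v in lborel. h v \<le> 0)"
    using h by (intro equilibrium_constant_sign) auto
  then have "AE v in lborel. h v = 0"
  proof
    assume "AE v in lborel. h v \<ge> 0"
    then show ?thesis using integral_nonneg_eq_0_iff_AE[of lborel h] h by simp
  next
    assume "AE v in lborel. h v \<le> 0"
    then show ?thesis using integral_nonneg_eq_0_iff_AE[of lborel "\<lambda>v. - h v"] h by simp
  qed
  then show ?thesis by eventually_elim (simp add: h_def)
qed

end

section \<open>Detailed balance, stationarity and uniqueness combined\<close>

theorem theorem2p2: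
  fixes m m1 eps th1 :: real and u1 :: vec3
  assumes "m > 0" and "m1 > 0" and "0 < eps" and "eps < 1" and "th1 > 0"
  shows "(\<forall>v v'. kern m m1 eps u1 th1 v v'
              * exp (- (m1 / (2 * th1)) * (1 + mu m m1 eps) * (norm (v' - u1))\<^sup>2)
            = kern m m1 eps u1 th1 v' v
              * exp (- (m1 / (2 * th1)) * (1 + mu m m1 eps) * (norm (v - u1))\<^sup>2))
       \<and> (\<forall>v. Qop m m1 eps u1 th1 (Msharp m m1 eps u1 th1) v = 0)
       \<and> (\<integral>v. Msharp m m1 eps u1 th1 v \<partial>lborel) = 1
       \<and> (\<forall>f :: vec3 \<Rightarrow> real.
            f \<in> borel_measurable lborel
            \<longrightarrow> integrable (density lborel (\<lambda>v. ennreal (1 + sigma m1 u1 th1 v))) f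
            \<longrightarrow> (AE v in lborel. Qop m m1 eps u1 th1 f v = 0)
            \<longrightarrow> (\<integral>v. f v \<partial>lborel) = 1
            \<longrightarrow> (AE v in lborel. f v = Msharp m m1 eps u1 th1 v))"
proof -
  interpret inelastic_gas m m1 eps th1 u1 using assms by unfold_locales
  have "AE v in lborel. f v = Msharp m m1 eps u1 th1 v"
    if "f \<in> borel_measurable lborel"
      and int: "integrable (density lborel (\<lambda>v. ennreal (1 + sigma m1 u1 th1 v))) f"
      and "AE v in lborel. Qop m m1 eps u1 th1 f v = 0" "(\<integral>v. f v \<partial>lborel) = 1" for f
  proof (rule equilibrium_unique)
    show f[measurable]: "f \<in> borel_measurable borel" using that(1) by simp
    have w: "integrable lborel (\<lambda>v. (1 + sig v) * f v)"
      using int by (subst (asm) integrable_density) (auto intro: add_nonneg_nonneg)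
    \<comment> \<open>Since \<open>sig\<close> is nonnegative, the weighted function dominates both
      \<open>f\<close> and \<open>sig v * f v\<close>, so one weighted integrability gives the two
      required ones.\<close>
    have le: "\<bar>f v\<bar> \<le> \<bar>(1 + sig v) * f v\<bar>" "\<bar>sig v * f v\<bar> \<le> \<bar>(1 + sig v) * f v\<bar>" for v
      using sigma_nonneg[of v] mult_right_mono[of 1 "1 + sig v" "\<bar>f v\<bar>"]
      by (simp_all only: abs_mult) (auto simp: distrib_right)
    show "integrable lborel f"
      by (rule Bochner_Integration.integrable_bound[OF w]) (use le in auto)
    show "integrable lborel (\<lambda>v. sig v * f v)"
      by (rule Bochner_Integration.integrable_bound[OF w]) (use le in auto)
  qed (use that in auto)
  then show ?thesis
    using kern_detailed_balance Qop_Msharp integral_Msharp by blast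
qed

end
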